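(* Let $n>2$ and consider the problem $\min_{x=[x_1;\dots;x_n]} f(x)$ subject to $Ax=\sum_{i=1}^nA_ix_i=b$, where $f:\mathbb{R}^{p_1}\times\cdots\times\mathbb{R}^{p_n}\to\mathbb{R}$ is convex (not necessarily separable), $A_i\in\mathbb{R}^{d\times p_i}$, $A=[A_1,\dots,A_n]$, $b\in\mathbb{R}^d$. Assume there is a KKT point $(x^*,\lambda^* )$, i.e. $Ax^*=b$ and $-A^\top\lambda^*\in\partial f(x^* )$. Let $0<\beta^{(0)}\le\beta^{(1)}\le\cdots$; let $L_i,P_i$ be symmetric with $P_i\succeq L_i\succeq0$; assume the function $x\mapsto\frac12\|Ax\|^2$ is $\{L_i'\}_{i=1}^n$-smooth, and let $G_i$ be symmetric with $G_i\succ L_i'-A_i^\top A_i$, $i=1,\dots,n$. From arbitrary $x^0,\lambda^0$, let $(x^k,\lambda^k)$ be generated, for $k=0,1,2,\dots$, by choosing $\hat f^k\in\mathcal{S}_{\{L_i,P_i\}_{i=1}^n}(f,x^k)$, $\hat f^k(x)=\sum_{i=1}^n\hat f_i^k(x_i)$, and setting, for all $i=1,\dots,n$ in parallel, $$x_i^{k+1}\in\arg\min_{x_i}\ \hat f_i^k(x_i)+\tfrac{\beta^{(k)}}{2}\Big\|A_ix_i+\sum_{j\ne i}A_jx_j^k-b+\tfrac{\lambda^k}{\beta^{(k)}}\Big\|^2+\tfrac{\beta^{(k)}}{2}\|x_i-x_i^k\|_{G_i}^2,$$ and $\lambda^{k+1}=\lambda^k+\beta^{(k)}(Ax^{k+1}-b)$.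 For any $K>0$ let $\bar x^K=\sum_{k=0}^K\gamma^{(k)}x^{k+1}$ with $\gamma^{(k)}=(\beta^{(k)})^{-1}/\sum_{l=0}^K(\beta^{(l)})^{-1}$. Then $$f(\bar x^K)-f(x^* )+\langle A^\top\lambda^*,\bar x^K-x^*\rangle+\frac{\beta^{(0)}\alpha}{2}\|A\bar x^K-b\|^2\le\frac{\sum_{i=1}^n\|x_i^*-x_i^0\|^2_{H_i^0}+\|\lambda^*-\lambda^0\|^2_{H_{n+1}^0}}{2\sum_{k=0}^K(\beta^{(k)})^{-1}},$$ where $\alpha=\min\left\{\frac12,\frac{\sigma^2_{\min}\left(\mathrm{Diag}\{A_i^\top A_i+G_i,\ i=1,\dots,n\}-A^\top A\right)}{2\|A\|_2^2}\right\}$, $H_i^0=\frac1{\beta^{(0)}}L_i+A_i^\top A_i+G_i$ for $i=1,\dots,n$, and $H_{n+1}^0=(1/\beta^{(0)})^2I$.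
   Context: Notation: $\|\cdot\|$ is the Euclidean norm, $\|M\|_2$ the spectral norm, $\sigma_{\min}(M)$ the smallest singular value and $\sigma^2_{\min}(M)=(\sigma_{\min}(M))^2$; for symmetric $M$, $\|a\|_M^2=a^\top M a$; $M\succeq N$ (resp. $M\succ N$) means $M-N$ is positive semidefinite (resp. positive definite); $\mathrm{Diag}\{M_i\}$ is the block-diagonal matrix with diagonal blocks $M_i$. $A\ne0$ is implicit in the definition of $\alpha$; minimizers of the subproblems are assumed to exist. Smoothness: a differentiable $g:\mathbb{R}^{p_1}\times\cdots\times\mathbb{R}^{p_n}\to\mathbb{R}$ is $\{L_i\}_{i=1}^n$-smooth ($L_i\succeq0$) if $|g(x)-g(y)-\langle\nabla g(y),x-y\rangle|\le\frac12\sum_{i=1}^n\|x_i-y_i\|_{L_i}^2$ for all $x,y$. Strong convexity: $g$ is $\{P_i\}_{i=1}^n$-strongly convex ($P_i\succeq0$) if for any $y_i\in\mathbb{R}^{p_i}$ the function $x\mapsto g(x)-\frac12\sum_{i=1}^n\|x_i-y_i\|_{P_i}^2$ is convex. Majorant first-order surrogate: $\hat f$ is a majorant first-order surrogate of $f$ near $\kappa=[\kappa_1;\dots;\kappa_n]$ (with matrices $L_i\succeq 0$) if (i) $\hat f(x)\ge f(x)$ for all $x$; (ii) $|\hat f(x)-f(x)|\le\frac12\sum_{i=1}^n\|x_i-\kappa_i\|_{L_i}^2$ for all $x$; (iii) $\hat f$ is separable: $\hat f(x)=\sum_{i=1}^n\hat f_i(x_i)$. $\mathcal{S}_{\{L_i,P_i\}_{i=1}^n}(f,\kappa)$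 is the set of such surrogates that are $\{P_i\}_{i=1}^n$-strongly convex. *)

theory Defs
  imports "HOL-Analysis.Analysis"
begin

text \<open>
  The space $R^{p_1} \times \cdots \times R^{p_n}$ with possibly different block dimensions is
  the Euclidean space \<open>real ^ 'm\<close>, where \<open>'n\<close> indexes the blocks and a surjection
  \<open>blk :: 'm \<Rightarrow> 'n\<close> assigns to every coordinate the block it belongs to; thus
  $p_i$ is the cardinality of the fibre \<open>{r. blk r = i}\<close>.  Objects attached to block
  \<open>i\<close> are stored padded with zeros: a vector of $R^{p_i}$ as a vector in
  \<open>block_space blk i\<close>, a $p_i \times p_i$ matrix as a matrix in \<open>block_mats blk i\<close>,
  and the $d \times p_i$ matrix $A_i$ as \<open>block_cols blk A i\<close>.  Inner products, norms and
  matrix products agree with those of the unpadded objects.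
\<close>

definition block_space :: "('m::finite \<Rightarrow> 'n::finite) \<Rightarrow> 'n \<Rightarrow> (real ^ 'm) set" where
  "block_space blk i = {v. \<forall>r. blk r \<noteq> i \<longrightarrow> v $ r = 0}"

definition block :: "('m::finite \<Rightarrow> 'n::finite) \<Rightarrow> 'n \<Rightarrow> real ^ 'm \<Rightarrow> real ^ 'm" where
  "block blk i x = (\<chi> r. if blk r = i then x $ r else 0)"

definition block_mats :: "('m::finite \<Rightarrow> 'n::finite) \<Rightarrow> 'n \<Rightarrow> (real ^ 'm ^ 'm) set" where
  "block_mats blk i = {M. \<forall>r c. blk r \<noteq> i \<or> blk c \<noteq> i \<longrightarrow> M $ r $ c = 0}"

definition block_cols ::
    "('m::finite \<Rightarrow> 'n::finite) \<Rightarrow> real ^ 'm ^ 'd::finite \<Rightarrow> 'n \<Rightarrow> real ^ 'm ^ 'd" where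
  "block_cols blk A i = (\<chi> r c. if blk c = i then A $ r $ c else 0)"

definition block_Diag ::
    "('m::finite \<Rightarrow> 'n::finite) \<Rightarrow> ('n \<Rightarrow> real ^ 'm ^ 'm) \<Rightarrow> real ^ 'm ^ 'm" where
  "block_Diag blk M = (\<chi> r c. if blk r = blk c then M (blk r) $ r $ c else 0)"

text \<open>The squared weighted norm $\|a\|_M^2 = a^T M a$.\<close>

definition wnorm2 :: "real ^ 'k ^ 'k \<Rightarrow> real ^ 'k::finite \<Rightarrow> real" where
  "wnorm2 M a = a \<bullet> (M *v a)"

text \<open>
  Symmetric, and positive (semi)definite, $p_i \times p_i$ matrices.  Definiteness is tested on
  the vectors of block \<open>i\<close> only: a padded matrix is never definite on the whole space as
  soon as there are other blocks.
\<close>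

definition block_sym :: "('m::finite \<Rightarrow> 'n::finite) \<Rightarrow> 'n \<Rightarrow> real ^ 'm ^ 'm \<Rightarrow> bool" where
  "block_sym blk i M \<longleftrightarrow> M \<in> block_mats blk i \<and> transpose M = M"

definition block_psd :: "('m::finite \<Rightarrow> 'n::finite) \<Rightarrow> 'n \<Rightarrow> real ^ 'm ^ 'm \<Rightarrow> bool" where
  "block_psd blk i M \<longleftrightarrow>
     block_sym blk i M \<and> (\<forall>v \<in> block_space blk i. 0 \<le> wnorm2 M v)"

definition block_pd :: "('m::finite \<Rightarrow> 'n::finite) \<Rightarrow> 'n \<Rightarrow> real ^ 'm ^ 'm \<Rightarrow> bool" where
  "block_pd blk i M \<longleftrightarrow>
     block_sym blk i M \<and> (\<forall>v \<in> block_space blk i. v \<noteq> 0 \<longrightarrow> 0 < wnorm2 M v)"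

definition block_smooth ::
    "('m::finite \<Rightarrow> 'n::finite) \<Rightarrow> ('n \<Rightarrow> real ^ 'm ^ 'm) \<Rightarrow> (real ^ 'm \<Rightarrow> real) \<Rightarrow> bool" where
  "block_smooth blk L g \<longleftrightarrow>
     (\<forall>i. block_psd blk i (L i)) \<and>
     (\<exists>grad. (\<forall>x. GDERIV g x :> grad x) \<and>
        (\<forall>x y. \<bar>g x - g y - grad y \<bullet> (x - y)\<bar>
           \<le> 1/2 * (\<Sum>i\<in>UNIV. wnorm2 (L i) (block blk i x - block blk i y))))"

definition block_strongly_convex ::
    "('m::finite \<Rightarrow> 'n::finite) \<Rightarrow> ('n \<Rightarrow> real ^ 'm ^ 'm) \<Rightarrow> (real ^ 'm \<Rightarrow> real) \<Rightarrow> bool" where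
  "block_strongly_convex blk P g \<longleftrightarrow>
     (\<forall>i. block_psd blk i (P i)) \<and>
     (\<forall>y. convex_on UNIV
        (\<lambda>x. g x - 1/2 * (\<Sum>i\<in>UNIV. wnorm2 (P i) (block blk i x - block blk i y))))"

definition separable :: "('m::finite \<Rightarrow> 'n::finite) \<Rightarrow> (real ^ 'm \<Rightarrow> real) \<Rightarrow> bool" where
  "separable blk g \<longleftrightarrow>
     (\<exists>h :: 'n \<Rightarrow> real ^ 'm \<Rightarrow> real. \<forall>x. g x = (\<Sum>i\<in>UNIV. h i (block blk i x)))"

definition majorant_surrogate ::
    "('m::finite \<Rightarrow> 'n::finite) \<Rightarrow> ('n \<Rightarrow> real ^ 'm ^ 'm) \<Rightarrow>
     (real ^ 'm \<Rightarrow> real) \<Rightarrow> real ^ 'm \<Rightarrow> (real ^ 'm \<Rightarrow> real) \<Rightarrow> bool" where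
  "majorant_surrogate blk L f \<kappa> g \<longleftrightarrow>
     (\<forall>i. block_psd blk i (L i)) \<and>
     (\<forall>x. f x \<le> g x) \<and>
     (\<forall>x. \<bar>g x - f x\<bar> \<le> 1/2 * (\<Sum>i\<in>UNIV. wnorm2 (L i) (block blk i x - block blk i \<kappa>))) \<and>
     separable blk g"

definition surrogates ::
    "('m::finite \<Rightarrow> 'n::finite) \<Rightarrow> ('n \<Rightarrow> real ^ 'm ^ 'm) \<Rightarrow> ('n \<Rightarrow> real ^ 'm ^ 'm) \<Rightarrow>
     (real ^ 'm \<Rightarrow> real) \<Rightarrow> real ^ 'm \<Rightarrow> (real ^ 'm \<Rightarrow> real) set" where
  "surrogates blk L P f \<kappa> =
     {g. majorant_surrogate blk L f \<kappa> g \<and> block_strongly_convex blk P g}"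

definition subdifferential :: "('a::real_inner \<Rightarrow> real) \<Rightarrow> 'a \<Rightarrow> 'a set" where
  "subdifferential f x = {g. \<forall>y. f x + g \<bullet> (y - x) \<le> f y}"

definition KKT_point ::
    "(real ^ 'm \<Rightarrow> real) \<Rightarrow> real ^ 'm::finite ^ 'd::finite \<Rightarrow> real ^ 'd \<Rightarrow>
     real ^ 'm \<Rightarrow> real ^ 'd \<Rightarrow> bool" where
  "KKT_point f A b x l \<longleftrightarrow> A *v x = b \<and> - (transpose A *v l) \<in> subdifferential f x"

text \<open>
  The singular values of a square matrix are the square roots of the eigenvalues of $M^T M$.
\<close>

definition singular_values :: "real ^ 'k ^ 'k::finite \<Rightarrow> real set" where
  "singular_values M =
     {s. 0 \<le> s \<and> (\<exists>v. v \<noteq> 0 \<and> (transpose M ** M) *v v = s\<^sup>2 *\<^sub>R v)}"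

definition sigma_min :: "real ^ 'k ^ 'k::finite \<Rightarrow> real" where
  "sigma_min M = Min (singular_values M)"

definition spectral_norm :: "real ^ 'm::finite ^ 'd::finite \<Rightarrow> real" where
  "spectral_norm M = onorm ((*v) M)"

end

theory Submission
  imports Defs
begin

text \<open>
  Put $Q = \mathrm{Diag}\{A_i^T A_i + G_i\} - A^T A$, which is positive semidefinite because
  $\frac12 \|Ax\|^2$ is $\{L_i'\}$-smooth.  Optimality of the parallel subproblems and the
  multiplier update bound the Lagrangian gap at $x^{k+1}$, divided by $\beta^{(k)}$, plus
  $\frac12 \|Ax^{k+1}-b\|^2$, by the decrease of
  $\frac12 (\frac{1}{\beta^{(k)}} \|x^*-x^k\|_L^2 + \|x^*-x^k\|_Q^2
    + \frac{1}{(\beta^{(k)})^2} \|\lambda^*-\lambda^k\|^2)$.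
  Telescoping and convexity give the bound even with $1$ in place of $\alpha \le \frac12$, so
  the smallest singular value plays no role.
\<close>

section \<open>Inner products and weighted squared norms\<close>

lemma transpose_mult_inner:
  fixes A :: "real ^ 'm::finite ^ 'd::finite"
  shows "(transpose A *v a) \<bullet> c = a \<bullet> (A *v c)"
  by (metis dot_lmul_matrix transpose_matrix_vector)

lemma sym_matrix_inner_commute:
  assumes "transpose M = M"
  shows "a \<bullet> (M *v c) = c \<bullet> (M *v (a :: real ^ 'k::finite))"
  by (metis assms inner_commute transpose_mult_inner)

lemma wnorm2_add_mat: "wnorm2 (M + N) a = wnorm2 M a + wnorm2 N a"
  by (simp add: wnorm2_def matrix_vector_mult_add_rdistrib inner_add_right)

lemma wnorm2_diff_mat: "wnorm2 (M - N) a = wnorm2 M a - wnorm2 N a"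
  by (simp add: wnorm2_def matrix_vector_mult_diff_rdistrib inner_diff_right)

lemma wnorm2_scaleR_mat: "wnorm2 (c *\<^sub>R M) a = c * wnorm2 M a"
  by (simp add: wnorm2_def scaleR_matrix_vector_assoc[symmetric])

lemma wnorm2_scaleR: "wnorm2 M (c *\<^sub>R a) = c\<^sup>2 * wnorm2 M a"
  by (simp add: wnorm2_def matrix_vector_mult_scaleR power2_eq_square)

lemma wnorm2_minus: "wnorm2 M (- a) = wnorm2 M a"
  using wnorm2_scaleR[of M "-1" a] by simp

lemma wnorm2_0: "wnorm2 M 0 = 0"
  by (simp add: wnorm2_def)

lemma wnorm2_mat: "wnorm2 (mat c) a = c * (norm a)\<^sup>2"
proof -
  have "mat c *v a = c *\<^sub>R a"
    by (simp add: vec_eq_iff matrix_vector_mult_def mat_def if_distrib[of "\<lambda>t. t * _"] cong: if_cong)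
  then show ?thesis
    by (simp add: wnorm2_def power2_norm_eq_inner)
qed

lemma wnorm2_gram: "wnorm2 (transpose B ** B) a = (norm (B *v a))\<^sup>2"
  by (metis wnorm2_def inner_commute matrix_vector_mul_assoc power2_norm_eq_inner transpose_mult_inner)

lemma wnorm2_add:
  assumes "transpose M = M"
  shows "wnorm2 M (a + c) = wnorm2 M a + 2 * (a \<bullet> (M *v c)) + wnorm2 M c"
  using sym_matrix_inner_commute[OF assms, of a c]
  by (simp add: wnorm2_def matrix_vector_right_distrib inner_add_left inner_add_right)

lemma norm_add_sq: "(norm (a + c))\<^sup>2 = (norm a)\<^sup>2 + 2 * (a \<bullet> c) + (norm (c :: 'a::real_inner))\<^sup>2"
  by (simp add: power2_norm_eq_inner inner_add_left inner_add_right inner_commute)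

section \<open>Decomposition of a vector into padded blocks\<close>

lemma block_add: "block blk i (a + c) = block blk i a + block blk i c"
  by (simp add: block_def vec_eq_iff)

lemma block_diff: "block blk i (a - c) = block blk i a - block blk i c"
  by (simp add: block_def vec_eq_iff)

lemma block_minus: "block blk i (- a) = - block blk i a"
  by (simp add: block_def vec_eq_iff)

lemma block_scaleR: "block blk i (t *\<^sub>R a) = t *\<^sub>R block blk i a"
  by (simp add: block_def vec_eq_iff)

lemma block_zero: "block blk i 0 = 0"
  by (simp add: block_def vec_eq_iff)

lemma block_block: "block blk i (block blk i a) = block blk i a"
  by (simp add: block_def vec_eq_iff)

lemma block_in_space: "block blk i a \<in> block_space blk i"
  by (simp add: block_def block_space_def)

lemma sum_block: "(\<Sum>i\<in>UNIV. block blk i a) = a"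
  by (simp add: block_def vec_eq_iff)

text \<open>Lets every product with a column block be traded for a product of the single matrix
  \<open>A\<close> with a padded block, the form used in all later estimates.\<close>

lemma block_cols_mult: "block_cols blk A i *v v = A *v block blk i v"
  unfolding block_cols_def block_def matrix_vector_mult_def vec_eq_iff
  by (auto intro!: sum.cong)

lemma sum_mult_block: "(\<Sum>i\<in>UNIV. A *v block blk i a) = A *v a"
  by (metis sum_block linear_sum matrix_vector_mul_linear)

lemma sum_inner_block: "(\<Sum>i\<in>UNIV. c \<bullet> (A *v block blk i a)) = c \<bullet> (A *v a)"
  by (metis sum_mult_block inner_sum_right)

lemma block_psd_wnorm2_nonneg:
  "block_psd blk i M \<Longrightarrow> 0 \<le> wnorm2 M (block blk i a)"
  by (simp add: block_psd_def block_in_space)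

section \<open>Convexity, smoothness and first-order tools\<close>

lemma convex_on_norm_affine_sq:
  fixes A :: "real ^ 'm::finite ^ 'd::finite"
  shows "convex_on UNIV (\<lambda>y. (norm (A *v y - b))\<^sup>2)"
proof (rule convex_onI)
  fix t :: real and y z :: "real ^ 'm"
  assume t: "0 < t" "t < 1"
  define p where "p = A *v y - b"
  define q where "q = A *v z - b"
  have "A *v ((1 - t) *\<^sub>R y + t *\<^sub>R z) - b = (1 - t) *\<^sub>R p + t *\<^sub>R q"
    by (simp add: p_def q_def matrix_vector_right_distrib matrix_vector_mult_scaleR algebra_simps)
  moreover have "(1 - t) * (norm p)\<^sup>2 + t * (norm q)\<^sup>2 - (norm ((1 - t) *\<^sub>R p + t *\<^sub>R q))\<^sup>2
      = t * (1 - t) * (norm (p - q))\<^sup>2"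
    by (simp add: power2_norm_eq_inner inner_commute algebra_simps)
  moreover have "0 \<le> t * (1 - t) * (norm (p - q))\<^sup>2"
    using t by simp
  ultimately show "(norm (A *v ((1 - t) *\<^sub>R y + t *\<^sub>R z) - b))\<^sup>2
      \<le> (1 - t) * (norm (A *v y - b))\<^sup>2 + t * (norm (A *v z - b))\<^sup>2"
    by (simp add: p_def q_def)
qed simp

text \<open>The gradient need not be identified: the smoothness bound at base point 0 is taken in
  the directions \<open>a\<close> and \<open>- a\<close>, and adding the two cancels the linear
  terms.\<close>

lemma block_smooth_gram_bound:
  fixes A :: "real ^ 'm::finite ^ 'd::finite"
  assumes "block_smooth blk L' (\<lambda>y. 1/2 * (norm (A *v y))\<^sup>2)"
  shows "(norm (A *v a))\<^sup>2 \<le> (\<Sum>i\<in>UNIV. wnorm2 (L' i) (block blk i a))"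
proof -
  obtain grad where g: "\<And>y z. \<bar>1/2 * (norm (A *v y))\<^sup>2 - 1/2 * (norm (A *v z))\<^sup>2 - grad z \<bullet> (y - z)\<bar>
      \<le> 1/2 * (\<Sum>i\<in>UNIV. wnorm2 (L' i) (block blk i y - block blk i z))"
    using assms unfolding block_smooth_def by blast
  have "A *v (- a) = - (A *v a)"
    using linear_neg[OF matrix_vector_mul_linear] by blast
  then show ?thesis
    using abs_le_D1[OF g[of a 0]] abs_le_D1[OF g[of "- a" 0]] by (simp add: block_zero block_minus wnorm2_minus)
qed

text \<open>Divide by \<open>t\<close> and let \<open>t\<close> tend to 0 from the right. This turns
  a comparison along a segment into a first-order condition.\<close>

lemma nonneg_linear_coeff:
  fixes a c :: real
  assumes "\<And>t. 0 < t \<Longrightarrow> t < 1 \<Longrightarrow> 0 \<le> t * a + t\<^sup>2 * c"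
  shows "0 \<le> a"
proof -
  have "((\<lambda>t. a + t * c) \<longlongrightarrow> a + 0 * c) (at_right 0)"
    by (intro tendsto_intros)
  moreover have "\<forall>\<^sub>F t in at_right 0. 0 \<le> a + t * c"
  proof (rule eventually_at_rightI[where b = 1])
    fix t :: real assume "t \<in> {0<..<1}"
    then have "0 \<le> t * (a + t * c)" "0 < t"
      using assms[of t] by (auto simp: power2_eq_square algebra_simps)
    then show "0 \<le> a + t * c"
      by (simp add: zero_le_mult_iff)
  qed simp
  ultimately have "0 \<le> a + 0 * c"
    by (intro tendsto_lowerbound) auto
  then show ?thesis by simp
qed

text \<open>
  The optimality condition of the subproblems, obtained by comparing \<open>u\<close> with
  \<open>u + t (y - u)\<close> as \<open>t\<close> tends to 0; no subgradient of the surrogate is needed.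
\<close>
lemma block_minimizers_three_point:
  fixes A :: "real ^ 'm::finite ^ 'd::finite" and h :: "'n::finite \<Rightarrow> real ^ 'm \<Rightarrow> real"
  assumes sc: "block_strongly_convex blk P (\<lambda>y. \<Sum>i\<in>UNIV. h i (block blk i y))"
    and G: "\<And>i. transpose (G i) = G i"
    and min: "\<And>i v. v \<in> block_space blk i \<Longrightarrow>
      h i (block blk i u) + \<beta> / 2 * (norm (A *v block blk i u + s i))\<^sup>2
        + \<beta> / 2 * wnorm2 (G i) (block blk i u - block blk i x)
      \<le> h i v + \<beta> / 2 * (norm (A *v block blk i v + s i))\<^sup>2
        + \<beta> / 2 * wnorm2 (G i) (v - block blk i x)"
  shows "(\<Sum>i\<in>UNIV. h i (block blk i u)) + 1/2 * (\<Sum>i\<in>UNIV. wnorm2 (P i) (block blk i (y - u)))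
    \<le> (\<Sum>i\<in>UNIV. h i (block blk i y))
      + \<beta> * (\<Sum>i\<in>UNIV. (A *v block blk i u + s i) \<bullet> (A *v block blk i (y - u))
          + block blk i (u - x) \<bullet> (G i *v block blk i (y - u)))"
    (is "?F u + 1/2 * ?p \<le> ?F y + \<beta> * ?l")
proof -
  define w where "w = y - u"
  define c where "c = (\<Sum>i\<in>UNIV. (norm (A *v block blk i w))\<^sup>2 + wnorm2 (G i) (block blk i w))"
  \<comment> \<open>The coefficient of \<open>t\<close> is the asserted inequality. Of the quadratic
    remainder, \<open>?p\<close> comes from strong convexity and \<open>c\<close> from expanding the
    squares in the subproblems.\<close>
  have "0 \<le> t * (?F y - ?F u - 1/2 * ?p + \<beta> * ?l) + t\<^sup>2 * (1/2 * ?p + \<beta> / 2 * c)"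
    if t: "0 < t" "t < 1" for t :: real
  proof -
    define z where "z = u + t *\<^sub>R w"
    have "h i (block blk i u) \<le> h i (block blk i z)
        + t * (\<beta> * ((A *v block blk i u + s i) \<bullet> (A *v block blk i w)
            + block blk i (u - x) \<bullet> (G i *v block blk i w)))
        + t\<^sup>2 * (\<beta> / 2 * ((norm (A *v block blk i w))\<^sup>2 + wnorm2 (G i) (block blk i w)))" for i
    proof -
      have e1: "A *v block blk i z + s i = (A *v block blk i u + s i) + t *\<^sub>R (A *v block blk i w)"
        by (simp add: z_def block_add block_scaleR matrix_vector_right_distrib matrix_vector_mult_scaleR)
      have e2: "block blk i (z - x) = block blk i (u - x) + t *\<^sub>R block blk i w"
        by (simp add: z_def block_add block_scaleR block_diff)
      show ?thesis
        using min[OF block_in_space, of i z]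
        unfolding block_block block_diff[symmetric] e1 e2 norm_add_sq[of "A *v block blk i u + s i"]
          wnorm2_add[OF G] wnorm2_scaleR
        by (simp add: matrix_vector_mult_scaleR power_mult_distrib algebra_simps)
    qed
    then have "?F u \<le> (\<Sum>i\<in>UNIV. h i (block blk i z)
        + t * (\<beta> * ((A *v block blk i u + s i) \<bullet> (A *v block blk i w)
            + block blk i (u - x) \<bullet> (G i *v block blk i w)))
        + t\<^sup>2 * (\<beta> / 2 * ((norm (A *v block blk i w))\<^sup>2 + wnorm2 (G i) (block blk i w))))"
      by (rule sum_mono)
    also have "\<dots> = ?F z + t * (\<beta> * ?l) + t\<^sup>2 * (\<beta> / 2 * c)"
      by (simp only: c_def w_def sum.distrib sum_distrib_left[symmetric])
    finally have 1: "?F u \<le> ?F z + t * (\<beta> * ?l) + t\<^sup>2 * (\<beta> / 2 * c)" .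
    \<comment> \<open>Centring the quadratic at \<open>u\<close> makes it vanish there, equal
      \<open>?p\<close> at \<open>y\<close> and \<open>t\<^sup>2 * ?p\<close> at \<open>z\<close>;
      hence the gain \<open>?p\<close> survives at first order in \<open>t\<close>.\<close>
    have conv: "convex_on UNIV (\<lambda>v. ?F v
        - 1/2 * (\<Sum>i\<in>UNIV. wnorm2 (P i) (block blk i v - block blk i u)))"
      using sc unfolding block_strongly_convex_def by blast
    have z: "z = (1 - t) *\<^sub>R u + t *\<^sub>R y"
      by (simp add: z_def w_def algebra_simps)
    have zu: "z - u = t *\<^sub>R (y - u)"
      by (simp add: z_def w_def)
    have "?F z - 1/2 * (t\<^sup>2 * ?p) \<le> (1 - t) * ?F u + t * (?F y - 1/2 * ?p)"
      using convex_onD[OF conv, of t u y] t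
      unfolding z[symmetric] block_diff[symmetric] zu block_scaleR wnorm2_scaleR sum_distrib_left[symmetric]
      by (simp add: block_zero wnorm2_0)
    with 1 show ?thesis by (simp add: algebra_simps)
  qed
  then have "0 \<le> ?F y - ?F u - 1/2 * ?p + \<beta> * ?l"
    by (rule nonneg_linear_coeff)
  then show ?thesis by simp
qed

text \<open>Serves the multiplier update: with \<open>a\<close> the optimal, \<open>c\<close> the
  new and \<open>e\<close> the old multiplier, the right-hand side telescopes up to its last
  term.\<close>

lemma norm_three_point:
  fixes a c :: "'a::real_inner"
  shows "2 * ((a - c) \<bullet> (c - e)) = (norm (a - e))\<^sup>2 - (norm (a - c))\<^sup>2 - (norm (c - e))\<^sup>2"
  by (simp add: power2_norm_eq_inner inner_commute algebra_simps)

theorem theorem2: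
  fixes blk :: "'m::finite \<Rightarrow> 'n::finite"
    and f :: "real ^ 'm \<Rightarrow> real"
    and A :: "real ^ 'm ^ 'd::finite"
    and b :: "real ^ 'd"
    and xs :: "real ^ 'm" and ls :: "real ^ 'd"
    and \<beta> :: "nat \<Rightarrow> real"
    and L P L' G :: "'n \<Rightarrow> real ^ 'm ^ 'm"
    and fh :: "nat \<Rightarrow> 'n \<Rightarrow> real ^ 'm \<Rightarrow> real"
    and x :: "nat \<Rightarrow> real ^ 'm" and l :: "nat \<Rightarrow> real ^ 'd"
    and K :: nat
  assumes n_gt_2: "CARD('n) > 2"
    and blk: "surj blk"
    and f_convex: "convex_on UNIV f"
    and A_nonzero: "A \<noteq> 0"
    and KKT: "KKT_point f A b xs ls"
    and \<beta>_pos: "0 < \<beta> 0"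
    and \<beta>_mono: "\<And>k. \<beta> k \<le> \<beta> (Suc k)"
    and L_sym: "\<And>i. block_sym blk i (L i)"
    and P_sym: "\<And>i. block_sym blk i (P i)"
    and L_psd: "\<And>i. block_psd blk i (L i)"
    and P_ge_L: "\<And>i. block_psd blk i (P i - L i)"
    and smooth: "block_smooth blk L' (\<lambda>y. 1/2 * (norm (A *v y))\<^sup>2)"
    and G_sym: "\<And>i. block_sym blk i (G i)"
    and G_gt: "\<And>i. block_pd blk i
      (G i - (L' i - transpose (block_cols blk A i) ** block_cols blk A i))"
    and surrogate: "\<And>k. (\<lambda>y. \<Sum>i\<in>UNIV. fh k i (block blk i y)) \<in> surrogates blk L P f (x k)"
    and x_step: "\<And>k i. is_arg_min
      (\<lambda>v. fh k i v
         + \<beta> k / 2 * (norm (block_cols blk A i *v v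
             + (\<Sum>j\<in>UNIV - {i}. block_cols blk A j *v block blk j (x k))
             - b + (1 / \<beta> k) *\<^sub>R l k))\<^sup>2
         + \<beta> k / 2 * wnorm2 (G i) (v - block blk i (x k)))
      (\<lambda>v. v \<in> block_space blk i)
      (block blk i (x (Suc k)))"
    and l_step: "\<And>k. l (Suc k) = l k + \<beta> k *\<^sub>R (A *v x (Suc k) - b)"
    and K_pos: "K > 0"
  shows
    "let \<gamma> = (\<lambda>k. inverse (\<beta> k) / (\<Sum>j=0..K. inverse (\<beta> j)));
         xbar = (\<Sum>k=0..K. \<gamma> k *\<^sub>R x (Suc k));
         AG = (\<lambda>i. transpose (block_cols blk A i) ** block_cols blk A i + G i);
         \<alpha> = min (1/2) ((sigma_min (block_Diag blk AG - transpose A ** A))\<^sup>2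
                          / (2 * (spectral_norm A)\<^sup>2));
         H = (\<lambda>i. (1 / \<beta> 0) *\<^sub>R L i + AG i);
         Hl = (mat ((1 / \<beta> 0)\<^sup>2) :: real ^ 'd ^ 'd)
     in f xbar - f xs + (transpose A *v ls) \<bullet> (xbar - xs)
          + \<beta> 0 * \<alpha> / 2 * (norm (A *v xbar - b))\<^sup>2
        \<le> ((\<Sum>i\<in>UNIV. wnorm2 (H i) (block blk i xs - block blk i (x 0)))
              + wnorm2 Hl (ls - l 0))
           / (2 * (\<Sum>k=0..K. inverse (\<beta> k)))"
proof -
  have \<beta>0: "\<beta> 0 \<le> \<beta> k" for k
    using lift_Suc_mono_le[of \<beta>, OF \<beta>_mono] by blast
  then have pos: "0 < \<beta> k" for k
    using \<beta>_pos order_less_le_trans by blast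
  have Ax: "A *v xs = b"
    using KKT by (simp add: KKT_point_def)
  have GT: "transpose (G i) = G i" for i
    using G_sym by (simp add: block_sym_def)

  \<comment> \<open>Quadratic forms and the potential\<close>
  define AG where "AG = (\<lambda>i. transpose (block_cols blk A i) ** block_cols blk A i + G i)"
  define D where "D = (\<lambda>a. \<Sum>i\<in>UNIV. wnorm2 (AG i) (block blk i a))"
  \<comment> \<open>\<open>Q\<close> is the form of the block-diagonal matrix with blocks
    \<open>AG i\<close> minus the Gram matrix of \<open>A\<close>; \<open>B\<close> below is the
    symmetric bilinear form of \<open>D\<close>. In the potential \<open>E\<close> the weights are
    those left after dividing an iteration by \<open>\<beta> k\<close>, so \<open>Q\<close> carries
    none.\<close>
  define Q where "Q = (\<lambda>a. D a - (norm (A *v a))\<^sup>2)"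
  define N where "N = (\<lambda>a. \<Sum>i\<in>UNIV. wnorm2 (L i) (block blk i a))"
  define B where "B = (\<lambda>a c. \<Sum>i\<in>UNIV. (A *v block blk i a) \<bullet> (A *v block blk i c)
      + block blk i a \<bullet> (G i *v block blk i c))"
  define gap where "gap = (\<lambda>y. f y - f xs + (transpose A *v ls) \<bullet> (y - xs))"
  define E where "E = (\<lambda>k. 1/2 * (N (xs - x k) / \<beta> k + Q (xs - x k) + (norm (ls - l k))\<^sup>2 / (\<beta> k)\<^sup>2))"

  have wAG: "wnorm2 (AG i) (block blk i a) = (norm (A *v block blk i a))\<^sup>2 + wnorm2 (G i) (block blk i a)" for i a
    by (simp add: AG_def wnorm2_add_mat wnorm2_gram block_cols_mult block_block)
  have N_nonneg: "0 \<le> N a" for a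
    unfolding N_def using L_psd by (intro sum_nonneg block_psd_wnorm2_nonneg) auto
  \<comment> \<open>Blockwise \<open>AG i\<close> dominates \<open>L' i\<close> by the choice of
    \<open>G i\<close>, and the sum of the \<open>L' i\<close> forms dominates the Gram form by
    smoothness.\<close>
  have Q_nonneg: "0 \<le> Q a" for a
  proof -
    have "wnorm2 (L' i) (block blk i a) \<le> wnorm2 (AG i) (block blk i a)" for i
    proof -
      have "0 \<le> wnorm2 (G i - (L' i - transpose (block_cols blk A i) ** block_cols blk A i)) (block blk i a)"
        using G_gt[of i] block_in_space[of blk i a] unfolding block_pd_def
        by (cases "block blk i a = 0") (auto simp: wnorm2_0 less_imp_le)
      then show ?thesis by (simp add: wnorm2_diff_mat wnorm2_add_mat AG_def)
    qed
    then have "(\<Sum>i\<in>UNIV. wnorm2 (L' i) (block blk i a)) \<le> D a"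
      unfolding D_def by (intro sum_mono) auto
    then show ?thesis
      using block_smooth_gram_bound[OF smooth, of a] by (simp add: Q_def)
  qed
  have E_nonneg: "0 \<le> E k" for k
    unfolding E_def using N_nonneg Q_nonneg less_imp_le[OF pos] by simp
  have D_add: "D (a + c) = D a + 2 * B a c + D c" for a c
    unfolding D_def B_def wAG block_add matrix_vector_right_distrib norm_add_sq wnorm2_add[OF GT]
    by (simp add: sum.distrib sum_distrib_left)

  \<comment> \<open>Decrease of the potential in one iteration\<close>
  have step: "gap (x (Suc k)) / \<beta> k + 1/2 * (norm (A *v x (Suc k) - b))\<^sup>2 \<le> E k - E (Suc k)" for k
  proof -
    define u where "u = x (Suc k)"
    define w where "w = xs - u"
    \<comment> \<open>All blocks share this residual. Since the other blocks stay at
      \<open>x k\<close>, the argument of the square in subproblem \<open>i\<close> is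
      \<open>r\<close> with the old contribution of block \<open>i\<close> replaced by the new
      one.\<close>
    define r where "r = A *v x k - b + (1 / \<beta> k) *\<^sub>R l k"
    let ?F = "\<lambda>y. \<Sum>i\<in>UNIV. fh k i (block blk i y)"
    have sc: "block_strongly_convex blk P ?F"
      and maj: "f u \<le> ?F u"
      and app: "\<bar>?F xs - f xs\<bar> \<le> 1/2 * N (xs - x k)"
      using surrogate[of k] unfolding surrogates_def majorant_surrogate_def N_def block_diff by auto
    have s: "(\<Sum>j\<in>UNIV - {i}. block_cols blk A j *v block blk j (x k)) = A *v x k - A *v block blk i (x k)" for i
      by (simp add: block_cols_mult block_block sum_diff1 sum_mult_block)
    have opt: "?F u + 1/2 * (\<Sum>i\<in>UNIV. wnorm2 (P i) (block blk i (xs - u)))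
      \<le> ?F xs + \<beta> k * (\<Sum>i\<in>UNIV. (A *v block blk i u + (r - A *v block blk i (x k))) \<bullet> (A *v block blk i (xs - u))
          + block blk i (u - x k) \<bullet> (G i *v block blk i (xs - u)))"
    proof (rule block_minimizers_three_point[OF sc GT])
      fix i v assume "v \<in> block_space blk i"
      then show "fh k i (block blk i u) + \<beta> k / 2 * (norm (A *v block blk i u + (r - A *v block blk i (x k))))\<^sup>2
          + \<beta> k / 2 * wnorm2 (G i) (block blk i u - block blk i (x k))
        \<le> fh k i v + \<beta> k / 2 * (norm (A *v block blk i v + (r - A *v block blk i (x k))))\<^sup>2
          + \<beta> k / 2 * wnorm2 (G i) (v - block blk i (x k))"
        using x_step[of k i] unfolding is_arg_min_linorder s
        by (auto simp: block_cols_mult block_block u_def r_def algebra_simps)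
    qed
    have lin: "(\<Sum>i\<in>UNIV. (A *v block blk i u + (r - A *v block blk i (x k))) \<bullet> (A *v block blk i (xs - u))
          + block blk i (u - x k) \<bullet> (G i *v block blk i (xs - u))) = B (u - x k) w + r \<bullet> (A *v w)"
    proof -
      have e: "A *v block blk i u + (r - A *v block blk i (x k)) = A *v block blk i (u - x k) + r" for i
        by (simp add: block_diff matrix_vector_mult_diff_distrib)
      show ?thesis
        unfolding e B_def w_def[symmetric] inner_add_left sum.distrib sum_inner_block by simp
    qed
    \<comment> \<open>The surrogate is exploited asymmetrically: majorization at \<open>u\<close>
      costs nothing, and the error at \<open>xs\<close> costs half of \<open>N (xs - x k)\<close>.
      Since \<open>P i\<close> dominates \<open>L i\<close>, strong convexity returns half of
      \<open>N w\<close>, so the \<open>N\<close> terms telescope.\<close>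
    have "N w \<le> (\<Sum>i\<in>UNIV. wnorm2 (P i) (block blk i (xs - u)))"
      unfolding N_def w_def
    proof (rule sum_mono)
      fix i
      show "wnorm2 (L i) (block blk i (xs - u)) \<le> wnorm2 (P i) (block blk i (xs - u))"
        using block_psd_wnorm2_nonneg[OF P_ge_L[of i], of "xs - u"] by (simp add: wnorm2_diff_mat)
    qed
    then have 1: "f u - f xs \<le> 1/2 * N (xs - x k) - 1/2 * N w + \<beta> k * (B (u - x k) w + r \<bullet> (A *v w))"
      using maj app opt unfolding lin by linarith
    define a where "a = A *v (u - x k)"
    define c where "c = A *v u - b"
    have Aw: "A *v w = - c"
      by (simp add: w_def c_def Ax matrix_vector_mult_diff_distrib)
    have l: "l (Suc k) = l k + \<beta> k *\<^sub>R c"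
      using l_step by (simp add: c_def u_def)
    \<comment> \<open>\<open>r\<close> is evaluated at the old point while the multiplier update
      uses the new one; \<open>a\<close> measures this error of the parallel scheme.\<close>
    have r: "\<beta> k *\<^sub>R r = l (Suc k) - \<beta> k *\<^sub>R a"
      using pos[of k]
      by (simp add: l r_def a_def c_def matrix_vector_mult_diff_distrib algebra_simps)
    have rw: "\<beta> k * (r \<bullet> (A *v w)) = - (l (Suc k) \<bullet> c) - \<beta> k * (a \<bullet> (A *v w))"
      unfolding inner_scaleR_left[symmetric] r by (simp add: Aw inner_diff_left)
    have w': "xs - x k = (u - x k) + w"
      by (simp add: w_def)
    \<comment> \<open>The error \<open>a\<close> turns the bilinear form of \<open>D\<close> into
      that of \<open>Q\<close>, so polarization yields \<open>Q\<close> terms. The negative term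
      \<open>Q (u - x k)\<close> is discarded below.\<close>
    have Q3: "2 * (B (u - x k) w - a \<bullet> (A *v w)) = Q (xs - x k) - Q (u - x k) - Q w"
      unfolding Q_def w' D_add matrix_vector_right_distrib norm_add_sq a_def by simp
    have ls: "(transpose A *v ls) \<bullet> (u - xs) = ls \<bullet> c"
      unfolding transpose_mult_inner by (simp add: c_def Ax matrix_vector_mult_diff_distrib)
    have "l (Suc k) - l k = \<beta> k *\<^sub>R c"
      by (simp add: l)
    \<comment> \<open>After division by \<open>2 * (\<beta> k)\<^sup>2\<close> the last term becomes
      the feasibility gain \<open>1/2 * (norm c)\<^sup>2\<close>.\<close>
    then have l3: "2 * \<beta> k * ((ls - l (Suc k)) \<bullet> c)
        = (norm (ls - l k))\<^sup>2 - (norm (ls - l (Suc k)))\<^sup>2 - (\<beta> k)\<^sup>2 * (norm c)\<^sup>2"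
      using norm_three_point[of ls "l (Suc k)" "l k"] by (simp add: power_mult_distrib)
    have "gap u \<le> 1/2 * N (xs - x k) - 1/2 * N w
        + \<beta> k / 2 * (2 * (B (u - x k) w - a \<bullet> (A *v w))) + (ls - l (Suc k)) \<bullet> c"
      using 1 rw unfolding gap_def ls by (simp add: algebra_simps)
    also have "\<dots> \<le> 1/2 * N (xs - x k) - 1/2 * N w
        + \<beta> k / 2 * (Q (xs - x k) - Q w) + (ls - l (Suc k)) \<bullet> c"
      using Q_nonneg[of "u - x k"] pos[of k] unfolding Q3 by simp
    finally have "gap u / \<beta> k \<le> (1/2 * N (xs - x k) - 1/2 * N w
        + \<beta> k / 2 * (Q (xs - x k) - Q w) + (ls - l (Suc k)) \<bullet> c) / \<beta> k"
      using pos[of k] by (simp add: divide_right_mono)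
    also have "\<dots> = 1/2 * (N (xs - x k) / \<beta> k - N w / \<beta> k + Q (xs - x k) - Q w
        + 2 * \<beta> k * ((ls - l (Suc k)) \<bullet> c) / (\<beta> k)\<^sup>2)"
      using pos[of k] by (simp add: field_simps power2_eq_square)
    also have "\<dots> = 1/2 * (N (xs - x k) / \<beta> k - N w / \<beta> k + Q (xs - x k) - Q w
        + (norm (ls - l k))\<^sup>2 / (\<beta> k)\<^sup>2 - (norm (ls - l (Suc k)))\<^sup>2 / (\<beta> k)\<^sup>2 - (norm c)\<^sup>2)"
      using pos[of k] unfolding l3 by (simp add: diff_divide_distrib)
    finally have 2: "gap u / \<beta> k + 1/2 * (norm c)\<^sup>2 \<le> E k
        - 1/2 * (N w / \<beta> k + Q w + (norm (ls - l (Suc k)))\<^sup>2 / (\<beta> k)\<^sup>2)"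
      by (simp add: E_def algebra_simps)
    \<comment> \<open>\<open>E (Suc k)\<close> is weighted by \<open>\<beta> (Suc k)\<close>,
      whereas the estimate above still has \<open>\<beta> k\<close>; monotonicity of the penalties
      closes this mismatch.\<close>
    have "N w / \<beta> (Suc k) \<le> N w / \<beta> k"
      using N_nonneg \<beta>_mono pos by (intro divide_left_mono mult_pos_pos) auto
    moreover have "(norm (ls - l (Suc k)))\<^sup>2 / (\<beta> (Suc k))\<^sup>2 \<le> (norm (ls - l (Suc k)))\<^sup>2 / (\<beta> k)\<^sup>2"
      using \<beta>_mono[of k] pos[of k] pos[of "Suc k"]
      by (intro divide_left_mono mult_pos_pos power_mono) auto
    ultimately show ?thesis
      using 2 unfolding E_def u_def c_def w_def by argo
  qed

  \<comment> \<open>Averaging the iterates\<close>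
  define S where "S = (\<Sum>k=0..K. inverse (\<beta> k))"
  define \<gamma> where "\<gamma> = (\<lambda>k. inverse (\<beta> k) / S)"
  define xbar where "xbar = (\<Sum>k=0..K. \<gamma> k *\<^sub>R x (Suc k))"
  \<comment> \<open>The fixed penalty \<open>\<beta> 0\<close> gives one convex function for all
    iterates, so Jensen applies; as \<open>\<beta> 0 / \<beta> k\<close> is at most 1, each
    iteration's feasibility gain pays for the penalty term.\<close>
  define \<Psi> where "\<Psi> = (\<lambda>y. gap y + \<beta> 0 / 2 * (norm (A *v y - b))\<^sup>2)"
  have S_pos: "0 < S"
    unfolding S_def using pos by (intro sum_pos) auto
  have \<Psi>_convex: "convex_on UNIV \<Psi>"
  proof -
    have "convex_on UNIV (\<lambda>y. (transpose A *v ls) \<bullet> (y - xs) - f xs)"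
      by (rule convex_onI) (auto simp: algebra_simps)
    then have "convex_on UNIV (\<lambda>y. (f y + ((transpose A *v ls) \<bullet> (y - xs) - f xs))
        + \<beta> 0 / 2 * (norm (A *v y - b))\<^sup>2)"
      using f_convex \<beta>_pos by (intro convex_on_add convex_on_cmul convex_on_norm_affine_sq) auto
    then show ?thesis by (simp add: \<Psi>_def gap_def algebra_simps)
  qed
  have "\<Psi> xbar \<le> (\<Sum>k=0..K. \<gamma> k * \<Psi> (x (Suc k)))"
    unfolding xbar_def
  proof (rule convex_on_sum[OF _ _ \<Psi>_convex])
    show "(\<Sum>k=0..K. \<gamma> k) = 1"
      using S_pos by (simp add: \<gamma>_def S_def sum_divide_distrib[symmetric])
    show "0 \<le> \<gamma> k" for k
      using S_pos pos[of k] by (simp add: \<gamma>_def)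
  qed auto
  \<comment> \<open>The averaging weights are proportional to \<open>1 / \<beta> k\<close>,
    precisely the factor in \<open>step\<close>, which makes the sum telescope.\<close>
  also have "\<dots> = (\<Sum>k=0..K. \<Psi> (x (Suc k)) / \<beta> k) / S"
    by (simp add: \<gamma>_def sum_distrib_left divide_inverse mult_ac)
  also have "\<dots> \<le> E 0 / S"
  proof (rule divide_right_mono)
    have "\<Psi> (x (Suc k)) / \<beta> k \<le> E k - E (Suc k)" for k
    proof -
      have "\<beta> 0 / \<beta> k * (norm (A *v x (Suc k) - b))\<^sup>2 \<le> 1 * (norm (A *v x (Suc k) - b))\<^sup>2"
        using \<beta>0[of k] pos[of k] by (intro mult_right_mono) auto
      then show ?thesis
        using step[of k] by (simp add: \<Psi>_def add_divide_distrib)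
    qed
    then have "(\<Sum>k=0..K. \<Psi> (x (Suc k)) / \<beta> k) \<le> (\<Sum>k=0..K. E k - E (Suc k))"
      by (rule sum_mono)
    also have "\<dots> = E 0 - E (Suc K)"
      using sum_telescope[of E K] by (simp add: atLeast0AtMost)
    also have "\<dots> \<le> E 0"
      using E_nonneg by simp
    finally show "(\<Sum>k=0..K. \<Psi> (x (Suc k)) / \<beta> k) \<le> E 0" .
  qed (use S_pos in simp)
  finally have main: "\<Psi> xbar \<le> E 0 / S" .

  \<comment> \<open>Comparison with the stated bound\<close>
  define \<alpha> where "\<alpha> = min (1/2) ((sigma_min (block_Diag blk AG - transpose A ** A))\<^sup>2
      / (2 * (spectral_norm A)\<^sup>2))"
  define R where "R = (\<Sum>i\<in>UNIV. wnorm2 ((1 / \<beta> 0) *\<^sub>R L i + AG i) (block blk i xs - block blk i (x 0)))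
      + wnorm2 (mat ((1 / \<beta> 0)\<^sup>2) :: real ^ 'd ^ 'd) (ls - l 0)"
  have "R = N (xs - x 0) / \<beta> 0 + D (xs - x 0) + (norm (ls - l 0))\<^sup>2 / (\<beta> 0)\<^sup>2"
    by (simp add: R_def N_def D_def wnorm2_add_mat wnorm2_scaleR_mat wnorm2_mat block_diff[symmetric]
        sum.distrib sum_divide_distrib power_divide)
  \<comment> \<open>\<open>R\<close> contains \<open>D\<close> where \<open>2 * E 0\<close> has
    \<open>Q\<close>; the difference is the nonnegative square of the norm of
    \<open>A *v (xs - x 0)\<close>.\<close>
  then have "E 0 \<le> 1/2 * R"
    by (simp add: E_def Q_def)
  then have "E 0 / S \<le> R / (2 * S)"
    using S_pos by (simp add: field_simps)
  moreover have "\<beta> 0 * \<alpha> / 2 * (norm (A *v xbar - b))\<^sup>2 \<le> \<beta> 0 / 2 * (norm (A *v xbar - b))\<^sup>2"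
    using \<beta>_pos by (intro mult_right_mono) (auto simp: \<alpha>_def)
  ultimately have "gap xbar + \<beta> 0 * \<alpha> / 2 * (norm (A *v xbar - b))\<^sup>2 \<le> R / (2 * S)"
    using main by (simp add: \<Psi>_def)
  then show ?thesis
    unfolding Let_def gap_def R_def \<alpha>_def AG_def xbar_def \<gamma>_def S_def .
qed

end
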